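(* Let $\vec v\in\mathbb{C}^{N+1}$ be an eigenvector of the matrix $J_N$ with eigenvalue $\mu$. Then $\vec v$ is an eigenvector of $T_N$ for some eigenvalue $\lambda$ of $T_N$, and the generating function $f(\vec v;z)$ satisfies the integral equation $$\frac{1}{2\pi i}\int_{\operatorname{Re}(w)=\frac12}\frac{1}{w^{N+1}(1-w)^{N+1}(1-z+zw)}\,f(\vec v;w)\,dw=\lambda f(\vec v;z)$$ and the third-order differential equation \begin{align*} \mu y &= z^2(1-z)^2y'''+3z(1-z)\big((N-1)z-N\big)y''\\ &\quad+N\big((2N-5)z^2+(2-5N)z+2N+1\big)y'\\ &\quad+N\big((2N+1)z+N^2+N+1\big)y \end{align*} with $y=f(\vec v;z)$.
   Context: $N$ is a nonnegative integer. $T_N$ is the $(N+1)\times(N+1)$ symmetric Pascal matrix, $(T_N)_{j,k}=\binom{j+k}{j}$ for $0\le j,k\le N$. $J_N$ is the $(N+1)\times(N+1)$ symmetric tridiagonal matrix with rows and columns indexed by $0,\dots,N$, diagonal entries $(J_N)_{n,n}=b(n)$ for $0\le n\le N$ and off-diagonal entries $(J_N)_{n-1,n}=(J_N)_{n,n-1}=a(n)$ for $1\le n\le N$, where $a(n)=(N+1)^2n-n^3$ and $b(n)=2n^3+3n^2+2n-(N+1)^2n$. For $\vec v=(v_k)_{k=0}^N\in\mathbb{C}^{N+1}$ the generating function is the polynomial $f(\vec v;z)=\sum_{k=0}^N v_kz^{N-k}$. Primes denote derivatives with respect to $z$.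
   Formalization: The integral equation is stated only for |z-1|<1 and for z=0, with absolute convergence; for other z it fails in general (for N=0, v=(1), the left side is 1/(1-z) instead of 1 when |z-1|>1, and on |z-1|=1, z≠0 a pole lies on the line). *)

theory Defs
  imports "HOL-Analysis.Analysis" "Jordan_Normal_Form.Char_Poly"
begin

unbundle no vec_syntax

definition pascal_mat :: "nat \<Rightarrow> complex Matrix.mat" where
  "pascal_mat N = Matrix.mat (N + 1) (N + 1) (\<lambda>(j, k). of_nat ((j + k) choose j))"

definition jacobi_a :: "nat \<Rightarrow> nat \<Rightarrow> int" where
  "jacobi_a N n = (int N + 1)^2 * int n - int n ^ 3"

definition jacobi_b :: "nat \<Rightarrow> nat \<Rightarrow> int" where
  "jacobi_b N n = 2 * int n ^ 3 + 3 * int n ^ 2 + 2 * int n - (int N + 1)^2 * int n"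

definition jacobi_mat :: "nat \<Rightarrow> complex Matrix.mat" where
  "jacobi_mat N = Matrix.mat (N + 1) (N + 1) (\<lambda>(i, j).
     if i = j then of_int (jacobi_b N i)
     else if j = i + 1 then of_int (jacobi_a N j)
     else if i = j + 1 then of_int (jacobi_a N i)
     else 0)"

definition gen_fun :: "nat \<Rightarrow> complex Matrix.vec \<Rightarrow> complex \<Rightarrow> complex" where
  "gen_fun N v z = (\<Sum>k\<le>N. (v $ k) * z ^ (N - k))"

text \<open>Integration along the line \<open>Re w = c\<close>, oriented upwards, in the parametrization
  \<open>w = c + \<i> t\<close> with \<open>dw = \<i> dt\<close>. Since the Bochner integral is \<open>0\<close> for non-integrable functions,
  absolute convergence is a separate predicate.\<close>

definition vline_integrable :: "real \<Rightarrow> (complex \<Rightarrow> complex) \<Rightarrow> bool" where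
  "vline_integrable c g \<longleftrightarrow> integrable lborel (\<lambda>t. g (Complex c t) * \<i>)"

definition vline_integral :: "real \<Rightarrow> (complex \<Rightarrow> complex) \<Rightarrow> complex" where
  "vline_integral c g = (\<integral>t. g (Complex c t) * \<i> \<partial>lborel)"

definition pascal_integrand ::
    "nat \<Rightarrow> complex Matrix.vec \<Rightarrow> complex \<Rightarrow> complex \<Rightarrow> complex" where
  "pascal_integrand N v z w =
     1 / (w ^ (N + 1) * (1 - w) ^ (N + 1) * (1 - z + z * w)) * gen_fun N v w"

text \<open>For \<open>z \<noteq> 0\<close> the integrand has the \<open>z\<close>-dependent pole \<open>w = 1 - 1/z\<close>. It lies strictly to the
  left of the line \<open>Re w = 1/2\<close> iff \<open>\<bar>z - 1\<bar> < 1\<close>, on the line iff \<open>\<bar>z - 1\<bar> = 1\<close> (the integral then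
  diverges in general), and to its right iff \<open>\<bar>z - 1\<bar> > 1\<close>, where the residue at the pole
  contributes to the integral and the integral equation fails in general (for \<open>N = 0\<close>, \<open>v = (1)\<close>,
  the integral is \<open>1 / (1 - z)\<close>, but \<open>\<lambda> f(v;z) = 1\<close>).
  For \<open>z = 0\<close> there is no such pole.\<close>

definition integral_domain :: "complex set" where
  "integral_domain = {z. norm (z - 1) < 1 \<or> z = 0}"

definition satisfies_integral_equation ::
    "nat \<Rightarrow> complex Matrix.vec \<Rightarrow> complex \<Rightarrow> bool" where
  "satisfies_integral_equation N v lam \<longleftrightarrow>
     (\<forall>z \<in> integral_domain.
        vline_integrable (1/2) (pascal_integrand N v z) \<and>
        1 / (2 * of_real pi * \<i>) * vline_integral (1/2) (pascal_integrand N v z)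
          = lam * gen_fun N v z)"

end

theory Submission
  imports Defs
begin

text \<open>The theorem has three parts, and two of them are instances of one summation by parts. Write
  \<open>J\<close> and \<open>T\<close> for the Jacobi and the Pascal matrix and \<open>a\<close>, \<open>b\<close> for the entries of \<open>J\<close>. Since \<open>a\<close> vanishes at \<open>0\<close> and at \<open>N + 1\<close>, the three-term operator
  given by \<open>J\<close> is self-adjoint for the bilinear form \<open>\<Sum>i\<le>N. g i * u i\<close> on arbitrary functions on the
  naturals, with no boundary terms (\<open>jacobi_op_self_adjoint\<close>). If \<open>u\<close> is an eigenfunction for \<open>\<mu>\<close>, then
  \<open>\<mu> * (\<Sum>i\<le>N. g i * u i)\<close> may thus be computed by letting the operator act on \<open>g\<close>.

  For \<open>g i = z ^ (N - i)\<close> the operator in the index \<open>i\<close> equals the third-order differential operator in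
  \<open>z\<close> (\<open>jacobi_op_powers_eq_differential\<close>), and the differential equation follows. For the row
  \<open>g i = (j + i) choose j\<close> of the Pascal matrix the operator may be moved from the index \<open>i\<close> to the
  index \<open>j\<close> (\<open>jacobi_op_pascal_kernel\<close>), so that \<open>T\<close> maps eigenfunctions of \<open>J\<close> for \<open>\<mu>\<close> to eigenfunctions
  for \<open>\<mu>\<close>. Because \<open>a(n) \<noteq> 0\<close> for \<open>1 \<le> n \<le> N\<close>, the recurrence determines an eigenfunction by its value
  at \<open>0\<close> (\<open>jacobi_eigenfunction_zero\<close>); the eigenspaces of \<open>J\<close> are therefore lines, and \<open>T v\<close> is a
  multiple of \<open>v\<close>.

  The integral equation only restates \<open>T v = \<lambda> v\<close>: for every \<open>v\<close> the integral is the generating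
  function of \<open>T v\<close> (\<open>has_line_integral_pascal_integrand\<close>). To see this, expand the kernel in powers of
  \<open>1 / (1 - w)\<close> by a finite geometric series. The terms are the integrals of
  \<open>1 / (w ^ (k + 1) * (1 - w) ^ (m + 1))\<close>, which satisfy Pascal's recurrence and so are the entries of
  \<open>T\<close> (\<open>has_line_integral_beta\<close>). The remainder of the series has all its poles to the left of the line
  and decays quadratically, so it contributes nothing (\<open>kernel_remainder_zero\<close>). No contour
  has to be closed: every vanishing integral is reduced to a primitive that is
  holomorphic along the line and tends to \<open>0\<close> at infinity.\<close>

section \<open>The Jacobi matrix as a three-term operator\<close>

text \<open>The action of \<open>J\<close> on functions defined on all naturals. The truncated index \<open>0 - 1\<close> and the index
  \<open>N + 1\<close>, which lies outside a vector, do no harm at \<open>i = 0\<close> and \<open>i = N\<close>, since there the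
  coefficient \<open>a\<close> is \<open>0\<close>.\<close>

definition jacobi_op :: "nat \<Rightarrow> (nat \<Rightarrow> complex) \<Rightarrow> nat \<Rightarrow> complex" where
  "jacobi_op N u i = of_int (jacobi_a N i) * u (i - 1) + of_int (jacobi_b N i) * u i
     + of_int (jacobi_a N (Suc i)) * u (Suc i)"

lemma jacobi_a_0 [simp]: "jacobi_a N 0 = 0"
  by (simp add: jacobi_a_def)

lemma jacobi_a_top [simp]: "jacobi_a N (Suc N) = 0"
  by (simp add: jacobi_a_def algebra_simps power2_eq_square power3_eq_cube)

text \<open>\<open>a(n) = n ((N + 1)\<^sup>2 - n\<^sup>2)\<close> is a product of positive factors.\<close>

lemma jacobi_a_nonzero:
  assumes "0 < n" "n \<le> N"
  shows "jacobi_a N n \<noteq> 0"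
proof -
  have "jacobi_a N n = int n * ((int N + 1)^2 - int n ^ 2)"
    by (simp add: jacobi_a_def algebra_simps power2_eq_square power3_eq_cube)
  moreover have "int n ^ 2 < (int N + 1)^2"
    using assms by (intro power_strict_mono) auto
  ultimately show ?thesis using assms by simp
qed

lemma jacobi_mat_mult_vec:
  assumes "v \<in> carrier_vec (N + 1)" "i \<le> N"
  shows "(jacobi_mat N *\<^sub>v v) $ i = jacobi_op N (($) v) i"
proof -
  let ?a = "\<lambda>n. complex_of_int (jacobi_a N n)" and ?b = "\<lambda>n. complex_of_int (jacobi_b N n)"
  have "(jacobi_mat N *\<^sub>v v) $ i = (\<Sum>j<N+1. jacobi_mat N $$ (i, j) * v $ j)"
    using assms by (auto simp: jacobi_mat_def scalar_prod_def atLeast0LessThan)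
  also have "\<dots> = (\<Sum>j<N+1. (if j = i - 1 then ?a i * v $ j else 0) +
      (if j = i then ?b i * v $ j else 0) + (if j = Suc i then ?a (Suc i) * v $ j else 0))"
    using assms by (intro sum.cong) (auto simp: jacobi_mat_def)
  also have "\<dots> = jacobi_op N (($) v) i"
    using assms by (cases "i = N") (auto simp: sum.distrib jacobi_op_def)
  finally show ?thesis .
qed

lemma pascal_mat_mult_vec:
  assumes "v \<in> carrier_vec (N + 1)" "i \<le> N"
  shows "(pascal_mat N *\<^sub>v v) $ i = (\<Sum>k\<le>N. of_nat ((i + k) choose i) * v $ k)"
  using assms by (auto simp: pascal_mat_def scalar_prod_def atLeast0LessThan lessThan_Suc_atMost)

text \<open>The form of summation by parts used below: both boundary terms vanish.\<close>

lemma sum_atMost_shift_zero_ends: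
  fixes h :: "nat \<Rightarrow> 'a::ab_group_add"
  assumes "h 0 = 0" "h (Suc N) = 0"
  shows "(\<Sum>i\<le>N. h (Suc i)) = (\<Sum>i\<le>N. h i)"
  using assms sum.atMost_Suc_shift[of h N] by simp

text \<open>The symmetry of \<open>J\<close>. The functions \<open>g\<close> and \<open>u\<close> are unrestricted outside \<open>{0..N}\<close>, which lets \<open>g\<close> be
  a power of \<open>z\<close> or a row of binomial coefficients.\<close>

lemma jacobi_op_self_adjoint:
  "(\<Sum>i\<le>N. g i * jacobi_op N u i) = (\<Sum>k\<le>N. jacobi_op N g k * u k)"
proof -
  let ?a = "\<lambda>n. complex_of_int (jacobi_a N n)" and ?b = "\<lambda>n. complex_of_int (jacobi_b N n)"
  have 1: "(\<Sum>i\<le>N. ?a i * g i * u (i - 1)) = (\<Sum>i\<le>N. ?a (Suc i) * g (Suc i) * u i)"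
    using sum_atMost_shift_zero_ends[of "\<lambda>i. ?a i * g i * u (i - 1)" N] by simp
  have 2: "(\<Sum>i\<le>N. ?a i * g (i - 1) * u i) = (\<Sum>i\<le>N. ?a (Suc i) * g i * u (Suc i))"
    using sum_atMost_shift_zero_ends[of "\<lambda>i. ?a i * g (i - 1) * u i" N] by simp
  have "(\<Sum>i\<le>N. g i * jacobi_op N u i) = (\<Sum>i\<le>N. ?a i * g i * u (i - 1))
     + (\<Sum>i\<le>N. ?b i * g i * u i) + (\<Sum>i\<le>N. ?a (Suc i) * g i * u (Suc i))"
    by (simp add: jacobi_op_def sum.distrib algebra_simps)
  also have "\<dots> = (\<Sum>k\<le>N. jacobi_op N g k * u k)"
    unfolding 1 2 [symmetric] by (simp add: jacobi_op_def sum.distrib algebra_simps)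
  finally show ?thesis .
qed

text \<open>Row \<open>l\<close> of the eigenvalue equation expresses \<open>a(l + 1) u(l + 1)\<close> through \<open>u(l)\<close> and \<open>u(l - 1)\<close>, and
  \<open>a(l + 1) \<noteq> 0\<close>. This is the reason why eigenspaces of \<open>J\<close> are at most one-dimensional.\<close>

lemma jacobi_eigenfunction_zero:
  assumes "\<And>i. i \<le> N \<Longrightarrow> jacobi_op N u i = \<mu> * u i" and "u 0 = 0" and "i \<le> N"
  shows "u i = 0"
  using assms(3)
proof (induction i rule: less_induct)
  case (less i)
  show ?case
  proof (cases i)
    case (Suc l)
    have "of_int (jacobi_a N (Suc l)) * u (Suc l) = 0"
      using assms(1)[of l] less.IH[of l] less.IH[of "l - 1"] less.prems Suc
      by (cases l) (simp_all add: jacobi_op_def assms(2))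
    then show ?thesis using jacobi_a_nonzero[of i N] Suc less.prems by simp
  qed (simp add: assms(2))
qed

section \<open>The Jacobi and Pascal matrices commute\<close>

text \<open>The neighbours of \<open>t = (j + k) choose j\<close> in its row are \<open>t * k / (j + k)\<close> and
  \<open>t * (j + k + 1) / (k + 1)\<close>. The factor \<open>k + 1\<close> of \<open>a(k + 1)\<close> cancels the second denominator, and
  multiplication by \<open>j + k\<close> clears the first.\<close>

lemma jacobi_op_binomial:
  "jacobi_op N (\<lambda>k. of_nat ((j + k) choose j)) k * of_nat (j + k)
   = of_nat ((j + k) choose j) * (of_nat k ^ 2 * ((of_nat N + 1)^2 - of_nat k ^ 2)
      + of_nat (j + k) * (of_int (jacobi_b N k)
        + of_nat (j + k + 1) * ((of_nat N + 1)^2 - (of_nat k + 1)^2)))"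
proof -
  let ?t = "of_nat ((j + k) choose j) :: complex"
  have up_nat: "Suc l * ((j + Suc l) choose j) = ((j + l) choose j) * (j + l + 1)" for l
  proof -
    have "Suc l * (Suc (l + j) choose Suc l) = Suc (l + j) * ((l + j) choose l)"
      using Suc_times_binomial_eq[of "l + j" l] by (simp only: mult.commute)
    moreover have "Suc (l + j) choose Suc l = (j + Suc l) choose j"
      using binomial_symmetric[of j "j + Suc l"] by (simp add: add.commute)
    moreover have "(l + j) choose l = (j + l) choose j"
      using binomial_symmetric[of j "j + l"] by (simp add: add.commute)
    ultimately show ?thesis
      by (metis Suc_eq_plus1 add.commute mult.commute)
  qed
  have up: "of_nat (Suc k) * of_nat ((j + Suc k) choose j) = ?t * of_nat (j + k + 1)"
    by (metis of_nat_mult up_nat)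
  have "k * ((j + (k - 1)) choose j) * (j + k) = ((j + k) choose j) * k ^ 2"
  proof (cases k)
    case (Suc l)
    have "k * ((j + (k - 1)) choose j) * (j + k) = Suc l * (((j + l) choose j) * (j + l + 1))"
      unfolding Suc One_nat_def diff_Suc_Suc diff_zero add_Suc_right add_0_right by (simp only: mult_ac)
    also have "\<dots> = ((j + k) choose j) * k ^ 2"
      unfolding up_nat[symmetric] Suc power2_eq_square by (simp only: mult_ac)
    finally show ?thesis .
  qed simp
  from arg_cong[OF this, of of_nat]
  have down: "of_nat k * of_nat ((j + (k - 1)) choose j) * of_nat (j + k) = ?t * of_nat k ^ 2"
    by (simp only: of_nat_mult of_nat_power)
  have a: "(of_int (jacobi_a N n) :: complex) = of_nat n * ((of_nat N + 1)^2 - of_nat n ^ 2)" for n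
    by (simp add: jacobi_a_def algebra_simps power2_eq_square power3_eq_cube)
  let ?M = "(of_nat N + 1)^2 :: complex"
  have "jacobi_op N (\<lambda>k. of_nat ((j + k) choose j)) k * of_nat (j + k)
      = (?M - of_nat k ^ 2) * (of_nat k * of_nat ((j + (k - 1)) choose j) * of_nat (j + k))
        + of_int (jacobi_b N k) * ?t * of_nat (j + k)
        + (?M - of_nat (Suc k) ^ 2) * (of_nat (Suc k) * of_nat ((j + Suc k) choose j)) * of_nat (j + k)"
    unfolding jacobi_op_def a by (simp only: ring_distribs mult_ac)
  also have "\<dots> = (?M - of_nat k ^ 2) * (?t * of_nat k ^ 2)
        + of_int (jacobi_b N k) * ?t * of_nat (j + k)
        + (?M - of_nat (Suc k) ^ 2) * (?t * of_nat (j + k + 1)) * of_nat (j + k)"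
    by (simp only: down up)
  also have "\<dots> = of_nat ((j + k) choose j) * (of_nat k ^ 2 * ((of_nat N + 1)^2 - of_nat k ^ 2)
      + of_nat (j + k) * (of_int (jacobi_b N k)
        + of_nat (j + k + 1) * ((of_nat N + 1)^2 - (of_nat k + 1)^2)))"
    by (simp add: algebra_simps)
  finally show ?thesis .
qed

text \<open>The commutation \<open>J T = T J\<close>, entry by entry. By the previous lemma it amounts to the symmetry in
  \<open>j\<close> and \<open>k\<close> of a polynomial.\<close>

lemma jacobi_op_pascal_kernel:
  "jacobi_op N (\<lambda>i. of_nat ((i + k) choose i)) j = jacobi_op N (\<lambda>i. of_nat ((j + i) choose j)) k"
proof (cases "j + k = 0")
  case False
  have sym: "(i + k) choose i = (k + i) choose k" for i k :: nat
    using binomial_symmetric[of i "i + k"] by (simp add: add.commute)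
  have poly: "y^2 * (M - y^2) + (x + y) * (2 * y^3 + 3 * y^2 + 2 * y - M * y
        + (x + y + 1) * (M - (y + 1)^2))
      = x^2 * (M - x^2) + (x + y) * (2 * x^3 + 3 * x^2 + 2 * x - M * x
        + (x + y + 1) * (M - (x + 1)^2))" for x y M :: complex
    by (simp add: power2_eq_square power3_eq_cube algebra_simps)
  have "jacobi_op N (\<lambda>i. of_nat ((k + i) choose k)) j * of_nat (j + k)
      = jacobi_op N (\<lambda>i. of_nat ((j + i) choose j)) k * of_nat (j + k)"
    using jacobi_op_binomial[of N k j] jacobi_op_binomial[of N j k]
      poly[of "of_nat j" "(of_nat N + 1)^2" "of_nat k"] sym[of j k]
    by (simp add: jacobi_b_def add.commute)
  then show ?thesis using False by (auto simp: sym[of _ k] simp del: of_nat_add)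
qed simp

text \<open>The commutation moves the operator from the index \<open>i\<close> to the summation index \<open>k\<close>, and
  self-adjointness moves it on to \<open>u\<close>.\<close>

lemma pascal_sum_jacobi_eigenfunction:
  assumes "\<And>i. i \<le> N \<Longrightarrow> jacobi_op N u i = \<mu> * u i"
  defines "T \<equiv> \<lambda>i. \<Sum>k\<le>N. of_nat ((i + k) choose i) * u k"
  shows "jacobi_op N T i = \<mu> * T i"
proof -
  have "jacobi_op N T i = (\<Sum>k\<le>N. jacobi_op N (\<lambda>i. of_nat ((i + k) choose i)) i * u k)"
    by (simp add: jacobi_op_def T_def sum_distrib_left sum.distrib algebra_simps)
  also have "\<dots> = (\<Sum>k\<le>N. jacobi_op N (\<lambda>k. of_nat ((i + k) choose i)) k * u k)"
    by (simp only: jacobi_op_pascal_kernel)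
  also have "\<dots> = (\<Sum>k\<le>N. of_nat ((i + k) choose i) * jacobi_op N u k)"
    by (simp only: jacobi_op_self_adjoint)
  also have "\<dots> = \<mu> * T i"
    by (simp add: assms(1) T_def sum_distrib_left mult_ac)
  finally show ?thesis .
qed

section \<open>The differential equation\<close>

lemma deriv_sum_powers:
  "deriv (\<lambda>z. \<Sum>k\<in>A. c k * z ^ e k) = (\<lambda>z::complex. \<Sum>k\<in>A. (c k * of_nat (e k)) * z ^ (e k - 1))"
  by (rule ext, rule DERIV_imp_deriv) (auto intro!: derivative_eq_intros simp: mult_ac)

text \<open>On monomials \<open>z ^ m\<close> with \<open>m = N - k\<close> the differential operator produces \<open>z ^ (m + 1)\<close>, \<open>z ^ m\<close> and
  \<open>z ^ (m - 1)\<close> with the coefficients \<open>a(k)\<close>, \<open>b(k)\<close> and \<open>a(k + 1)\<close>. The derivatives of \<open>z ^ m\<close> are written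
  with truncated subtraction; this is exact, since the factor in front of a truncated exponent is
  \<open>0\<close>.\<close>

lemma jacobi_op_powers_eq_differential:
  fixes z :: complex
  assumes "k \<le> N"
  defines "m \<equiv> N - k" and "n \<equiv> of_nat N"
  shows "jacobi_op N (\<lambda>i. z ^ (N - i)) k =
     z^2 * (1 - z)^2 * (of_nat m * of_nat (m - 1) * of_nat (m - 1 - 1) * z ^ (m - 1 - 1 - 1))
     + 3 * z * (1 - z) * ((n - 1) * z - n) * (of_nat m * of_nat (m - 1) * z ^ (m - 1 - 1))
     + n * ((2 * n - 5) * z^2 + (2 - 5 * n) * z + 2 * n + 1) * (of_nat m * z ^ (m - 1))
     + n * ((2 * n + 1) * z + n^2 + n + 1) * z ^ m"
proof -
  have N: "N = m + k" using assms by simp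
  have up: "of_int (jacobi_a N k) * z ^ (N - (k - 1)) = of_int (jacobi_a N k) * (z * z ^ m)"
    by (cases k) (simp_all add: N Suc_diff_le)
  have dn: "N - Suc k = m - 1" "N - k = m" by (simp_all add: N)
  have k: "of_nat k = (n - of_nat m :: complex)" by (simp add: n_def N)
  let ?m = "of_nat m :: complex"
  have a: "(of_int (jacobi_a N k) :: complex) = (n - ?m) * (?m + 1) * (2 * n + 1 - ?m)"
    "(of_int (jacobi_a N (Suc k)) :: complex) = (n - ?m + 1) * (2 * n + 2 - ?m) * ?m"
    "(of_int (jacobi_b N k) :: complex) = 2 * (n - ?m)^3 + 3 * (n - ?m)^2
       + 2 * (n - ?m) - (n + 1)^2 * (n - ?m)"
    by (simp_all add: jacobi_a_def jacobi_b_def k n_def[symmetric])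
       (simp_all add: algebra_simps power2_eq_square power3_eq_cube)
  define P where "P = ?m * z ^ (m - 1)"
  have P1: "z * P = ?m * z ^ m" by (cases m) (simp_all add: P_def)
  have P2: "z * (?m * of_nat (m - 1) * z ^ (m - 1 - 1)) = (?m - 1) * P"
    by (cases "m - 1"; cases m) (simp_all add: P_def)
  have P3: "z^2 * (?m * of_nat (m - 1) * of_nat (m - 1 - 1) * z ^ (m - 1 - 1 - 1))
      = (?m - 1) * (?m - 2) * P"
    by (cases "m - 1 - 1"; cases "m - 1"; cases m)
       (simp_all add: P_def power2_eq_square)
  \<comment> \<open>By P2 and P3 every derivative term is a polynomial in \<open>z\<close> times \<open>P\<close>. All powers of \<open>z\<close> in front
     of \<open>P\<close> but the constant term are then converted to \<open>z ^ m\<close> and \<open>z * z ^ m\<close> by P1.\<close>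
  have "z^2 * (1 - z)^2 * (?m * of_nat (m - 1) * of_nat (m - 1 - 1) * z ^ (m - 1 - 1 - 1))
     + 3 * z * (1 - z) * ((n - 1) * z - n) * (?m * of_nat (m - 1) * z ^ (m - 1 - 1))
     + n * ((2 * n - 5) * z^2 + (2 - 5 * n) * z + 2 * n + 1) * P
     + n * ((2 * n + 1) * z + n^2 + n + 1) * z ^ m
    = (1 - z)^2 * ((?m - 1) * (?m - 2) * P)
     + 3 * (1 - z) * ((n - 1) * z - n) * ((?m - 1) * P)
     + n * ((2 * n - 5) * z^2 + (2 - 5 * n) * z + 2 * n + 1) * P
     + n * ((2 * n + 1) * z + n^2 + n + 1) * z ^ m"
    unfolding P2[symmetric] P3[symmetric] by (simp only: mult_ac)
  also have "\<dots> = ((?m - 1) * (?m - 2) - 3 * n * (?m - 1) + n * (2 * n + 1)) * P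
     + (- 2 * (?m - 1) * (?m - 2) + 3 * (2 * n - 1) * (?m - 1) + n * (2 - 5 * n)) * (z * P)
     + ((?m - 1) * (?m - 2) - 3 * (n - 1) * (?m - 1) + n * (2 * n - 5)) * z * (z * P)
     + n * ((2 * n + 1) * z + n^2 + n + 1) * z ^ m"
    by (simp add: algebra_simps power2_eq_square)
  also have "\<dots> = of_int (jacobi_a N k) * (z * z ^ m) + of_int (jacobi_b N k) * z ^ m
     + (n - ?m + 1) * (2 * n + 2 - ?m) * P"
    unfolding P1 a by (simp add: algebra_simps power2_eq_square power3_eq_cube)
  also have "\<dots> = jacobi_op N (\<lambda>i. z ^ (N - i)) k"
    unfolding jacobi_op_def up dn P_def a(2) by (simp only: mult_ac)
  finally show ?thesis unfolding P_def by (rule sym)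
qed

lemma gen_fun_differential_eq:
  fixes z :: complex
  assumes "\<And>i. i \<le> N \<Longrightarrow> jacobi_op N (($) v) i = \<mu> * v $ i"
  defines "y \<equiv> gen_fun N v" and "n \<equiv> (of_nat N :: complex)"
  shows "\<mu> * y z =
              z^2 * (1 - z)^2 * (deriv ^^ 3) y z
              + 3 * z * (1 - z) * ((n - 1) * z - n) * (deriv ^^ 2) y z
              + n * ((2 * n - 5) * z^2 + (2 - 5 * n) * z + 2 * n + 1) * deriv y z
              + n * ((2 * n + 1) * z + n^2 + n + 1) * y z"
proof -
  have y: "y = (\<lambda>z. \<Sum>k\<le>N. v $ k * z ^ (N - k))" by (simp add: y_def gen_fun_def fun_eq_iff)
  have collect: "(A * (a * b * c * x3) + B * (a * b * x2) + C * (a * x1) + D * x0) * w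
      = A * (w * a * b * c * x3) + B * (w * a * b * x2) + C * (w * a * x1) + D * (w * x0)"
    for A B C D a b c w x0 x1 x2 x3 :: complex by (simp add: algebra_simps)
  have d1: "deriv y = (\<lambda>z. \<Sum>k\<le>N. v $ k * of_nat (N - k) * z ^ (N - k - 1))"
    unfolding y by (rule deriv_sum_powers)
  have d2: "(deriv ^^ 2) y = (\<lambda>z. \<Sum>k\<le>N. v $ k * of_nat (N - k) * of_nat (N - k - 1)
      * z ^ (N - k - 1 - 1))"
    unfolding numeral_2_eq_2 funpow.simps o_def id_def d1 by (rule deriv_sum_powers)
  have funpow_3: "(deriv ^^ 3) y = deriv ((deriv ^^ 2) y)"
    by (simp add: numeral_2_eq_2 numeral_3_eq_3)
  have d3: "(deriv ^^ 3) y = (\<lambda>z. \<Sum>k\<le>N. v $ k * of_nat (N - k) * of_nat (N - k - 1)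
      * of_nat (N - k - 1 - 1) * z ^ (N - k - 1 - 1 - 1))"
    using deriv_sum_powers by (simp only: funpow_3 d2)
  have "\<mu> * y z = (\<Sum>k\<le>N. z ^ (N - k) * jacobi_op N (($) v) k)"
    by (simp add: assms(1) y sum_distrib_left mult_ac)
  also have "\<dots> = (\<Sum>k\<le>N. jacobi_op N (\<lambda>i. z ^ (N - i)) k * v $ k)"
    by (rule jacobi_op_self_adjoint)
  also have "\<dots> = z^2 * (1 - z)^2 * (deriv ^^ 3) y z
              + 3 * z * (1 - z) * ((n - 1) * z - n) * (deriv ^^ 2) y z
              + n * ((2 * n - 5) * z^2 + (2 - 5 * n) * z + 2 * n + 1) * deriv y z
              + n * ((2 * n + 1) * z + n^2 + n + 1) * y z"
    unfolding d1 d2 d3 fun_cong[OF y, of z] sum_distrib_left sum.distrib[symmetric]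
    using jacobi_op_powers_eq_differential[of _ N z]
    by (intro sum.cong refl) (simp only: atMost_iff n_def collect)
  finally show ?thesis .
qed

section \<open>Integrals along the line \<open>Re w = 1/2\<close>\<close>

text \<open>The normalization is that of \<open>1 / (2 \<pi> \<i>) \<integral> g(w) dw\<close>: the factor \<open>\<i>\<close> of \<open>dw = \<i> dt\<close> cancels the one in
  the prefactor, so \<open>I\<close> is this normalized integral. Absolute convergence is part of the notion.\<close>

definition has_line_integral :: "(complex \<Rightarrow> complex) \<Rightarrow> complex \<Rightarrow> bool" where
  "has_line_integral g I \<longleftrightarrow>
     has_bochner_integral lborel (\<lambda>t. g (Complex (1/2) t)) (2 * of_real pi * I)"

lemma has_line_integral_vline:
  assumes "has_line_integral g I"
  shows "vline_integrable (1/2) g"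
    and "1 / (2 * of_real pi * \<i>) * vline_integral (1/2) g = I"
proof -
  have *: "has_bochner_integral lborel (\<lambda>t. g (Complex (1/2) t) * \<i>) (2 * of_real pi * I * \<i>)"
    using assms unfolding has_line_integral_def by (intro has_bochner_integral_mult_left) auto
  then show "vline_integrable (1/2) g"
    by (simp add: vline_integrable_def has_bochner_integral_iff)
  from * show "1 / (2 * of_real pi * \<i>) * vline_integral (1/2) g = I"
    by (simp add: vline_integral_def has_bochner_integral_iff)
qed

lemma has_line_integral_add:
  "has_line_integral f I \<Longrightarrow> has_line_integral g J \<Longrightarrow> has_line_integral (\<lambda>w. f w + g w) (I + J)"
  unfolding has_line_integral_def ring_distribs by (rule has_bochner_integral_add)

lemma has_line_integral_cmult:
  assumes "has_line_integral f I"
  shows "has_line_integral (\<lambda>w. c * f w) (c * I)"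
  using has_bochner_integral_mult_right[of c lborel "\<lambda>t. f (Complex (1/2) t)" "2 * of_real pi * I"] assms
  by (simp add: has_line_integral_def mult_ac)

lemma has_line_integral_sum:
  "(\<And>i. i \<in> A \<Longrightarrow> has_line_integral (f i) (I i)) \<Longrightarrow>
     has_line_integral (\<lambda>w. \<Sum>i\<in>A. f i w) (\<Sum>i\<in>A. I i)"
  unfolding has_line_integral_def sum_distrib_left by (rule has_bochner_integral_sum)

lemma has_line_integral_cong:
  assumes "has_line_integral f I" "\<And>w. Re w = 1/2 \<Longrightarrow> f w = g w"
  shows "has_line_integral g I"
  using assms by (simp add: has_line_integral_def)

lemma has_bochner_integral_inverse_quarter_plus_square:
  "has_bochner_integral lborel (\<lambda>t::real. inverse (1/4 + t^2)) (2 * pi)"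
proof -
  let ?F = "\<lambda>t::real. 2 * arctan (2 * t)"
  have nz: "1/4 + t^2 \<noteq> 0" for t :: real
    by (smt (verit) zero_le_power2 divide_pos_pos)
  have D: "(?F has_real_derivative inverse (1/4 + t^2)) (at t)" for t :: real
    by (auto intro!: derivative_eq_intros simp: field_simps nz add_nonneg_eq_0_iff)
  have top: "filterlim (\<lambda>t::real. 2 * t) at_top at_top"
    by (rule filterlim_tendsto_pos_mult_at_top[OF tendsto_const _ filterlim_ident]) simp
  have bot: "filterlim (\<lambda>t::real. 2 * t) at_bot at_bot"
    by (rule filterlim_tendsto_pos_mult_at_bot[OF tendsto_const _ filterlim_ident]) simp
  have lims: "(?F \<longlongrightarrow> 2 * (- (pi/2))) at_bot" "(?F \<longlongrightarrow> 2 * (pi/2)) at_top"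
    by (intro tendsto_mult_left filterlim_compose[OF tendsto_arctan_at_bot bot]
        filterlim_compose[OF tendsto_arctan_at_top top])+
  have "set_integrable lborel (einterval (-\<infinity>) \<infinity>) (\<lambda>t::real. inverse (1/4 + t^2))"
    "(LBINT t=-\<infinity>..\<infinity>. inverse (1/4 + t^2)) = 2 * (pi/2) - 2 * (- (pi/2))"
    using lims by (intro interval_integral_FTC_nonneg[where F = ?F] D continuous_intros;
       simp add: ereal_tendsto_simps nz)+
  then show ?thesis
    by (simp add: has_bochner_integral_iff set_integrable_def interval_integral_to_infinity_eq
        interval_lebesgue_integral_def set_lebesgue_integral_def)
qed

text \<open>On the line \<open>1 - w\<close> is the complex conjugate of \<open>w\<close>, so the integrand is \<open>1 / (1/4 + t\<^sup>2)\<close>.\<close>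

lemma has_line_integral_base: "has_line_integral (\<lambda>w. 1 / (w * (1 - w))) 1"
proof -
  have "has_bochner_integral lborel (\<lambda>t. complex_of_real (inverse (1/4 + t^2))) (of_real (2 * pi))"
    by (rule has_bochner_integral_of_real[OF has_bochner_integral_inverse_quarter_plus_square])
  moreover have "complex_of_real (inverse (1/4 + t^2))
      = 1 / (Complex (1/2) t * (1 - Complex (1/2) t))" for t
  proof -
    have "Complex (1/2) t * (1 - Complex (1/2) t) = of_real (1/4 + t^2)"
      by (simp add: complex_eq_iff power2_eq_square)
    then show ?thesis by (simp add: inverse_eq_divide)
  qed
  ultimately show ?thesis by (simp add: has_line_integral_def)
qed

text \<open>The distance \<open>\<delta>\<close> of the pole from the line bounds all factors but one; the remaining one decays
  like \<open>1 / \<bar>w\<bar>\<close>. Two such factors give an integrable majorant.\<close>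

lemma inverse_power_bound_on_line:
  assumes "Re p \<noteq> 1/2"
  shows "\<exists>C\<ge>0. \<forall>w. Re w = 1/2 \<longrightarrow> norm (1 / (w - p) ^ Suc k) \<le> C / norm w"
proof -
  define \<delta> where "\<delta> = \<bar>1/2 - Re p\<bar>"
  define C where "C = (1 + norm p / \<delta>) / \<delta> ^ k"
  have \<delta>: "\<delta> > 0" using assms by (simp add: \<delta>_def)
  have C: "C \<ge> 0" using \<delta> by (simp add: C_def)
  have "norm (1 / (w - p) ^ Suc k) \<le> C / norm w" if w: "Re w = 1/2" for w
  proof -
    have d: "\<delta> \<le> norm (w - p)"
      using abs_Re_le_cmod[of "w - p"] w by (simp add: \<delta>_def)
    have w0: "norm w > 0" using w by auto
    have "norm w \<le> norm (w - p) + norm p"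
      using norm_triangle_ineq[of "w - p" p] by simp
    also have "norm p \<le> norm (w - p) * (norm p / \<delta>)"
      using mult_right_mono[OF d, of "norm p / \<delta>"] \<delta> by simp
    finally have "norm w \<le> norm (w - p) * (1 + norm p / \<delta>)"
      by (simp add: ring_distribs)
    moreover have "\<delta> ^ k \<le> norm (w - p) ^ k" using d \<delta> by (intro power_mono) auto
    ultimately have "norm w * \<delta> ^ k \<le> norm (w - p) * (1 + norm p / \<delta>) * norm (w - p) ^ k"
      using \<delta> by (intro mult_mono) auto
    then have "norm w \<le> C * norm (w - p) ^ Suc k"
      using \<delta> by (simp add: C_def field_simps)
    moreover have "norm (w - p) ^ Suc k > 0" using d \<delta> by (intro zero_less_power) linarith
    ultimately have "1 / norm (w - p) ^ Suc k \<le> C / norm w"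
      using w0 by (simp only: divide_le_eq le_divide_eq times_divide_eq_left if_True mult_1)
    then show ?thesis by (simp only: norm_divide norm_power norm_one)
  qed
  then show ?thesis using C by blast
qed

lemma continuous_on_line:
  assumes "Re p \<noteq> 1/2" "Re q \<noteq> 1/2"
  shows "continuous_on UNIV (\<lambda>t. 1 / ((Complex (1/2) t - p) ^ i * (Complex (1/2) t - q) ^ j))"
proof -
  have "Complex (1/2) t - p \<noteq> 0" "Complex (1/2) t - q \<noteq> 0" for t using assms by auto
  then show ?thesis by (auto simp: Complex_eq intro!: continuous_intros)
qed

lemma integrable_on_line:
  assumes "Re p \<noteq> 1/2" "Re q \<noteq> 1/2"
  shows "integrable lborel (\<lambda>t. 1 / ((Complex (1/2) t - p) ^ Suc i * (Complex (1/2) t - q) ^ Suc j))"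
proof -
  obtain C where C: "C \<ge> 0" "\<And>w. Re w = 1/2 \<Longrightarrow> norm (1 / (w - p) ^ Suc i) \<le> C / norm w"
    using inverse_power_bound_on_line[OF assms(1)] by metis
  obtain D where D: "D \<ge> 0" "\<And>w. Re w = 1/2 \<Longrightarrow> norm (1 / (w - q) ^ Suc j) \<le> D / norm w"
    using inverse_power_bound_on_line[OF assms(2)] by metis
  show ?thesis
  proof (rule Bochner_Integration.integrable_bound)
    show "integrable lborel (\<lambda>t. C * D * inverse (1/4 + t^2))"
      using has_bochner_integral_inverse_quarter_plus_square
      by (intro integrable_mult_right) (simp add: has_bochner_integral_iff)
    show "(\<lambda>t. 1 / ((Complex (1/2) t - p) ^ Suc i * (Complex (1/2) t - q) ^ Suc j))
        \<in> borel_measurable lborel"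
      using borel_measurable_continuous_onI[OF continuous_on_line[OF assms, of "Suc i" "Suc j"]]
      by (simp only: measurable_lborel2)
    show "AE t in lborel. norm (1 / ((Complex (1/2) t - p) ^ Suc i * (Complex (1/2) t - q) ^ Suc j))
        \<le> norm (C * D * inverse (1/4 + t^2))"
    proof (rule AE_I2)
      fix t :: real
      let ?w = "Complex (1/2) t"
      have "norm (1 / ((?w - p) ^ Suc i * (?w - q) ^ Suc j))
          = norm (1 / (?w - p) ^ Suc i) * norm (1 / (?w - q) ^ Suc j)"
        by (simp add: norm_divide norm_mult)
      also have "\<dots> \<le> (C / norm ?w) * (D / norm ?w)"
        using C D by (intro mult_mono) auto
      also have "\<dots> = C * D * inverse (norm ?w ^ 2)"
        by (simp add: power2_eq_square field_simps)
      also have "norm ?w ^ 2 = 1/4 + t^2"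
        unfolding cmod_power2 by (simp add: power2_eq_square)
      finally show "norm (1 / ((?w - p) ^ Suc i * (?w - q) ^ Suc j))
        \<le> norm (C * D * inverse (1/4 + t^2))"
        using C(1) D(1) by (simp add: abs_mult)
    qed
  qed
qed

text \<open>The fundamental theorem of calculus on the whole line. It takes the place of Cauchy's theorem for
  all integrals that vanish.\<close>

lemma has_line_integral_zero_of_primitive:
  assumes F: "\<And>w. Re w = 1/2 \<Longrightarrow> (F has_field_derivative g w) (at w)"
    and lim: "(F \<longlongrightarrow> 0) at_infinity"
    and int: "integrable lborel (\<lambda>t. g (Complex (1/2) t))"
    and cont: "continuous_on UNIV (\<lambda>t. g (Complex (1/2) t))"
  shows "has_line_integral g 0"
proof -
  let ?c = "\<lambda>t. Complex (1/2) t"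
  have "filterlim ?c at_infinity at_infinity"
    unfolding filterlim_at_infinity_conv_norm_at_top
    by (rule filterlim_at_top_mono[OF filterlim_norm_at_top]) 
       (auto intro!: always_eventually abs_Im_le_cmod[of "Complex _ _", simplified])
  then have c: "filterlim ?c at_infinity at_top" "filterlim ?c at_infinity at_bot"
    by (auto simp: at_infinity_eq_at_top_bot filterlim_sup intro: filterlim_mono)
  have deriv: "((\<lambda>t. F (?c t)) has_vector_derivative \<i> * g (?c t)) (at t)" for t
  proof -
    have "(?c has_vector_derivative \<i>) (at t)"
      by (auto simp: Complex_eq intro!: derivative_eq_intros)
    from field_vector_diff_chain_at[OF this F] show ?thesis by (simp add: o_def)
  qed
  have "(LBINT t=-\<infinity>..\<infinity>. \<i> * g (?c t)) = 0 - 0"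
  proof (rule interval_integral_FTC_integrable)
    show "isCont (\<lambda>t. \<i> * g (?c t)) t" for t
      using cont by (intro continuous_intros) (simp add: continuous_on_eq_continuous_at)
    show "set_integrable lborel (einterval (-\<infinity>) \<infinity>) (\<lambda>t. \<i> * g (?c t))"
      using int by (simp add: set_integrable_def)
    show "(((\<lambda>t. F (?c t)) \<circ> real_of_ereal) \<longlongrightarrow> 0) (at_right (-\<infinity>))"
      "(((\<lambda>t. F (?c t)) \<circ> real_of_ereal) \<longlongrightarrow> 0) (at_left \<infinity>)"
      unfolding ereal_tendsto_simps using filterlim_compose[OF lim] c by auto
  qed (use deriv in auto)
  then have "(\<integral>t. \<i> * g (?c t) \<partial>lborel) = 0"
    by (simp add: interval_lebesgue_integral_def set_lebesgue_integral_def)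
  then show ?thesis
    using int by (simp add: has_line_integral_def has_bochner_integral_iff)
qed

text \<open>A single multiple pole has a rational primitive that tends to \<open>0\<close>, on whichever side of the line the
  pole lies.\<close>

lemma has_line_integral_inverse_power:
  assumes "Re p \<noteq> 1/2"
  shows "has_line_integral (\<lambda>w. 1 / (w - p) ^ Suc (Suc k)) 0"
proof (rule has_line_integral_zero_of_primitive)
  fix w assume "Re w = 1/2"
  then have "w - p \<noteq> 0" using assms by auto
  then show "((\<lambda>w. - (inverse (w - p) ^ Suc k / of_nat (Suc k))) has_field_derivative
      1 / (w - p) ^ Suc (Suc k)) (at w)"
    by (auto intro!: derivative_eq_intros simp del: of_nat_Suc power_Suc simp: divide_simps)
       (simp add: algebra_simps)
next
  have "filterlim (\<lambda>w. w - p) at_infinity at_infinity"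
    using tendsto_add_filterlim_at_infinity'[OF filterlim_ident tendsto_const[of "- p"]] by simp
  then have "((\<lambda>w. inverse (w - p)) \<longlongrightarrow> 0) at_infinity"
    by (rule filterlim_compose[OF tendsto_inverse_0])
  then have "((\<lambda>w. - (inverse (w - p) ^ Suc k / of_nat (Suc k))) \<longlongrightarrow> - (0 ^ Suc k / of_nat (Suc k))) at_infinity"
    by (intro tendsto_intros) (auto simp del: of_nat_Suc)
  then show "((\<lambda>w. - (inverse (w - p) ^ Suc k / of_nat (Suc k))) \<longlongrightarrow> 0) at_infinity" by simp
next
  show "integrable lborel (\<lambda>t. 1 / (Complex (1/2) t - p) ^ Suc (Suc k))"
    using integrable_on_line[OF assms assms, of 0 k] by simp
  show "continuous_on UNIV (\<lambda>t. 1 / (Complex (1/2) t - p) ^ Suc (Suc k))"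
    using continuous_on_line[OF assms assms, of 1 "Suc k"] by simp
qed

text \<open>All poles lie to the left of the line, so that the line could be moved off to the right. The proof
  uses the primitive \<open>Ln (1 - p / w) / p\<close> for \<open>k = 0\<close>. Here \<open>1 - p / w\<close> avoids the branch cut along the
  line just because \<open>Re p < 1/2\<close>. For \<open>p \<noteq> 0\<close>, partial fractions lower the order of the pole at \<open>0\<close>.\<close>

lemma has_line_integral_two_left_poles:
  assumes p: "Re p < 1/2"
  shows "has_line_integral (\<lambda>w. 1 / (w ^ Suc k * (w - p))) 0"
proof (cases "p = 0")
  case True
  then show ?thesis
    using has_line_integral_inverse_power[of 0 k] by (simp add: mult_ac)
next
  case p0: False
  show ?thesis
  proof (induction k)
    case 0
    show ?case
    proof (rule has_line_integral_zero_of_primitive)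
      fix w assume w: "Re w = 1/2"
      have w0: "w \<noteq> 0" "w - p \<noteq> 0" using w p by auto
      have "1 - p / w \<notin> \<real>\<^sub>\<le>\<^sub>0"
      proof
        assume "1 - p / w \<in> \<real>\<^sub>\<le>\<^sub>0"
        then obtain r where r: "r \<ge> 0" "1 - p / w = - of_real r"
          by (auto elim!: nonpos_Reals_cases) (metis minus_minus neg_0_le_iff_le of_real_minus)
        have "p = of_real (1 + r) * w"
          using r(2) w0(1) by (simp add: field_simps)
        then have "Re p = (1 + r) / 2" using w by simp
        then show False using p r(1) by simp
      qed
      then show "((\<lambda>w. Ln (1 - p / w) / p) has_field_derivative 1 / (w ^ Suc 0 * (w - p))) (at w)"
        using w0 p0 by (auto intro!: derivative_eq_intros simp: field_simps)
    next
      have "((\<lambda>w. p / w) \<longlongrightarrow> 0) at_infinity"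
        by (rule tendsto_divide_0[OF tendsto_const filterlim_ident])
      then have "((\<lambda>w. Ln (1 - p / w) / p) \<longlongrightarrow> Ln (1 - 0) / p) at_infinity"
        using p0 by (intro tendsto_intros) auto
      then show "((\<lambda>w. Ln (1 - p / w) / p) \<longlongrightarrow> 0) at_infinity" by simp
    next
      show "integrable lborel (\<lambda>t. 1 / (Complex (1/2) t ^ Suc 0 * (Complex (1/2) t - p)))"
        using integrable_on_line[of 0 p 0 0] p by simp
      show "continuous_on UNIV (\<lambda>t. 1 / (Complex (1/2) t ^ Suc 0 * (Complex (1/2) t - p)))"
        using continuous_on_line[of 0 p 1 1] p by simp
    qed
  next
    case (Suc k)
    have "has_line_integral (\<lambda>w. (1/p) * (1 / (w ^ Suc k * (w - p)))
        + (- 1/p) * (1 / (w - 0) ^ Suc (Suc k))) ((1/p) * 0 + (- 1/p) * 0)"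
      by (intro has_line_integral_add has_line_integral_cmult Suc.IH has_line_integral_inverse_power) simp
    then have "has_line_integral (\<lambda>w. (1/p) * (1 / (w ^ Suc k * (w - p)))
        + (- 1/p) * (1 / (w - 0) ^ Suc (Suc k))) 0" by simp
    then show ?case
    proof (rule has_line_integral_cong)
      fix w assume "Re w = 1/2"
      then have "w \<noteq> 0" "w - p \<noteq> 0" using p by auto
      then show "(1/p) * (1 / (w ^ Suc k * (w - p))) + (- 1/p) * (1 / (w - 0) ^ Suc (Suc k))
          = 1 / (w ^ Suc (Suc k) * (w - p))"
        using p0 by (simp add: divide_simps)
    qed
  qed
qed

text \<open>Multiplying the integrand by \<open>w + (1 - w) = 1\<close>.\<close>

lemma has_line_integral_pascal_recurrence:
  assumes "has_line_integral (\<lambda>w. 1 / (w ^ k * (1 - w) ^ Suc m)) I"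
    and "has_line_integral (\<lambda>w. 1 / (w ^ Suc k * (1 - w) ^ m)) J"
  shows "has_line_integral (\<lambda>w. 1 / (w ^ Suc k * (1 - w) ^ Suc m)) (I + J)"
proof (rule has_line_integral_cong[OF has_line_integral_add[OF assms]])
  fix w :: complex assume "Re w = 1/2"
  then have "w \<noteq> 0" "1 - w \<noteq> 0" by auto
  then show "1 / (w ^ k * (1 - w) ^ Suc m) + 1 / (w ^ Suc k * (1 - w) ^ m)
      = 1 / (w ^ Suc k * (1 - w) ^ Suc m)"
    by (simp add: divide_simps)
qed

text \<open>The entries of the Pascal matrix as integrals: both sides satisfy Pascal's recurrence, and the
  boundary cases, where one of the two poles is absent, have integral \<open>0\<close>.\<close>

lemma has_line_integral_beta:
  "has_line_integral (\<lambda>w. 1 / (w ^ Suc k * (1 - w) ^ Suc m)) (of_nat ((m + k) choose m))"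
proof (induction k arbitrary: m)
  case 0
  show ?case
  proof (induction m)
    case 0
    show ?case using has_line_integral_base by simp
  next
    case (Suc m)
    have "has_line_integral (\<lambda>w. (-1) ^ m * (1 / (w - 1) ^ Suc (Suc m))) ((-1) ^ m * 0)"
      by (intro has_line_integral_cmult has_line_integral_inverse_power) simp
    moreover have "(-1) ^ m * (1 / (w - 1) ^ Suc (Suc m)) = 1 / (w ^ 0 * (1 - w) ^ Suc (Suc m))"
      for w :: complex
      using power_minus[of "w - 1" "Suc (Suc m)"] by (cases "even m") auto
    ultimately have "has_line_integral (\<lambda>w. 1 / (w ^ 0 * (1 - w) ^ Suc (Suc m))) 0" by simp
    from has_line_integral_pascal_recurrence[OF this Suc.IH] show ?case by simp
  qed
next
  case (Suc k)
  note IH = Suc.IH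
  show ?case
  proof (induction m)
    case 0
    have "has_line_integral (\<lambda>w. 1 / (w ^ Suc (Suc k) * (1 - w) ^ 0)) 0"
      using has_line_integral_inverse_power[of 0 k] by simp
    from has_line_integral_pascal_recurrence[OF IH[of 0] this] show ?case by simp
  next
    case (Suc m)
    from has_line_integral_pascal_recurrence[OF IH[of "Suc m"] Suc.IH] show ?case
      by (simp add: add_ac)
  qed
qed

section \<open>The integral with the Pascal kernel\<close>

text \<open>The condition \<open>\<bar>z - 1\<bar> < 1\<close> means \<open>\<bar>z\<bar>\<^sup>2 < 2 Re z\<close>, that is \<open>Re (1 / z) > 1/2\<close>.\<close>

lemma Re_kernel_pole_less_half:
  assumes "norm (z - 1) < 1" "z \<noteq> 0"
  shows "Re (1 - 1 / z) < 1/2"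
proof -
  have "norm (z - 1) ^ 2 < 1" using assms(1) by (simp add: power_less_one_iff)
  then have *: "(Re z)\<^sup>2 + (Im z)\<^sup>2 < 2 * Re z"
    unfolding cmod_power2 by (simp add: power2_eq_square algebra_simps)
  have "(Re z)\<^sup>2 + (Im z)\<^sup>2 > 0"
    using assms(2) by (simp add: complex_neq_0)
  with * show ?thesis by (simp add: Re_divide field_simps)
qed

text \<open>For \<open>z \<noteq> 0\<close> the linear factor has its root at \<open>1 - 1 / z\<close>, to the left of the line. The factor
  \<open>z ^ Suc N\<close> covers \<open>z = 0\<close>, where the other factor is \<open>1 / w ^ Suc k\<close> and its integral does not
  converge absolutely if \<open>k = 0\<close>.\<close>

lemma kernel_remainder_zero:
  assumes "z \<in> integral_domain"
  shows "has_line_integral (\<lambda>w. z ^ Suc N * (1 / (w ^ Suc k * (1 - z * (1 - w))))) 0"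
    and "\<And>w. Re w = 1/2 \<Longrightarrow> 1 - z * (1 - w) \<noteq> 0"
proof -
  have "has_line_integral (\<lambda>w. z ^ Suc N * (1 / (w ^ Suc k * (1 - z * (1 - w))))) 0
      \<and> (\<forall>w. Re w = 1/2 \<longrightarrow> 1 - z * (1 - w) \<noteq> 0)"
  proof (cases "z = 0")
    case True
    then show ?thesis by (simp add: has_line_integral_def has_bochner_integral_zero)
  next
    case False
    define p where "p = 1 - 1 / z"
    have p: "Re p < 1/2" unfolding p_def
      using assms False by (intro Re_kernel_pole_less_half) (auto simp: integral_domain_def)
    have f: "1 - z * (1 - w) = z * (w - p)" for w
      using False by (simp add: p_def field_simps)
    have "has_line_integral (\<lambda>w. z ^ N * (1 / (w ^ Suc k * (w - p)))) (z ^ N * 0)"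
      by (intro has_line_integral_cmult has_line_integral_two_left_poles p)
    moreover have "z ^ N * (1 / (w ^ Suc k * (w - p)))
        = z ^ Suc N * (1 / (w ^ Suc k * (1 - z * (1 - w))))" for w
      using False by (simp add: f)
    moreover have "1 - z * (1 - w) \<noteq> 0" if "Re w = 1/2" for w
      using p that False by (auto simp: f)
    ultimately show ?thesis by simp
  qed
  then show "has_line_integral (\<lambda>w. z ^ Suc N * (1 / (w ^ Suc k * (1 - z * (1 - w))))) 0"
    and "\<And>w. Re w = 1/2 \<Longrightarrow> 1 - z * (1 - w) \<noteq> 0" by auto
qed

text \<open>The finite geometric series for \<open>1 / (1 - z * u)\<close>, divided by \<open>u ^ Suc N\<close>. It separates the pole
  at \<open>u = 0\<close> from the pole at \<open>u = 1 / z\<close>.\<close>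

lemma geometric_kernel_expansion:
  fixes u z :: "'a::field"
  assumes "u \<noteq> 0" "1 - z * u \<noteq> 0"
  shows "1 / (u ^ Suc N * (1 - z * u))
     = (\<Sum>m\<le>N. z ^ (N - m) / u ^ Suc m) + z ^ Suc N / (1 - z * u)"
proof (induction N)
  case 0
  show ?case using assms by (simp add: field_simps)
next
  case (Suc N)
  have "1 / (u ^ Suc (Suc N) * (1 - z * u))
      = 1 / u ^ Suc (Suc N) + z * (1 / (u ^ Suc N * (1 - z * u)))"
    using assms by (simp add: divide_simps)
  also have "z * (1 / (u ^ Suc N * (1 - z * u)))
      = (\<Sum>m\<le>N. z ^ (Suc N - m) / u ^ Suc m) + z ^ Suc (Suc N) / (1 - z * u)"
    unfolding Suc.IH by (simp add: ring_distribs sum_distrib_left Suc_diff_le)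
  finally show ?case by simp
qed

lemma has_line_integral_monomial_kernel:
  assumes "z \<in> integral_domain"
  shows "has_line_integral (\<lambda>w. 1 / (w ^ Suc k * (1 - w) ^ Suc N * (1 - z * (1 - w))))
     (\<Sum>m\<le>N. z ^ (N - m) * of_nat ((m + k) choose m))"
proof -
  have "has_line_integral (\<lambda>w. (\<Sum>m\<le>N. z ^ (N - m) * (1 / (w ^ Suc k * (1 - w) ^ Suc m)))
        + z ^ Suc N * (1 / (w ^ Suc k * (1 - z * (1 - w)))))
      ((\<Sum>m\<le>N. z ^ (N - m) * of_nat ((m + k) choose m)) + 0)"
    by (intro has_line_integral_add has_line_integral_sum has_line_integral_cmult
        has_line_integral_beta kernel_remainder_zero(1) assms)
  then have "has_line_integral (\<lambda>w. (\<Sum>m\<le>N. z ^ (N - m) * (1 / (w ^ Suc k * (1 - w) ^ Suc m)))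
        + z ^ Suc N * (1 / (w ^ Suc k * (1 - z * (1 - w)))))
      (\<Sum>m\<le>N. z ^ (N - m) * of_nat ((m + k) choose m))" by simp
  then show ?thesis
  proof (rule has_line_integral_cong)
    fix w :: complex assume w: "Re w = 1/2"
    have "1 - w \<noteq> 0" using w by auto
    from geometric_kernel_expansion[OF this kernel_remainder_zero(2)[OF assms w], of N]
    have "1 / w ^ Suc k * (1 / ((1 - w) ^ Suc N * (1 - z * (1 - w))))
      = 1 / w ^ Suc k * ((\<Sum>m\<le>N. z ^ (N - m) / (1 - w) ^ Suc m) + z ^ Suc N / (1 - z * (1 - w)))"
      by (simp only:)
    then show "(\<Sum>m\<le>N. z ^ (N - m) * (1 / (w ^ Suc k * (1 - w) ^ Suc m)))
        + z ^ Suc N * (1 / (w ^ Suc k * (1 - z * (1 - w))))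
      = 1 / (w ^ Suc k * (1 - w) ^ Suc N * (1 - z * (1 - w)))"
      by (simp add: ring_distribs sum_distrib_left mult_ac)
  qed
qed

text \<open>The integral operator carries the generating function of \<open>v\<close> to that of \<open>T v\<close>, for every \<open>v\<close>.\<close>

lemma has_line_integral_pascal_integrand:
  assumes "z \<in> integral_domain"
  shows "has_line_integral (pascal_integrand N v z)
     (\<Sum>m\<le>N. (\<Sum>k\<le>N. of_nat ((m + k) choose m) * v $ k) * z ^ (N - m))"
proof -
  have "has_line_integral (\<lambda>w. \<Sum>k\<le>N. v $ k * (1 / (w ^ Suc k * (1 - w) ^ Suc N * (1 - z * (1 - w)))))
      (\<Sum>k\<le>N. v $ k * (\<Sum>m\<le>N. z ^ (N - m) * of_nat ((m + k) choose m)))"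
    by (intro has_line_integral_sum has_line_integral_cmult has_line_integral_monomial_kernel assms)
  also have "(\<Sum>k\<le>N. v $ k * (\<Sum>m\<le>N. z ^ (N - m) * of_nat ((m + k) choose m)))
      = (\<Sum>m\<le>N. (\<Sum>k\<le>N. of_nat ((m + k) choose m) * v $ k) * z ^ (N - m))"
    unfolding sum_distrib_left sum_distrib_right by (subst sum.swap) (simp only: mult_ac)
  finally show ?thesis
  proof (rule has_line_integral_cong)
    fix w :: complex assume w: "Re w = 1/2"
    then have "w \<noteq> 0" by auto
    then have e: "w ^ (N - k) / w ^ (N + 1) = 1 / w ^ Suc k" if "k \<le> N" for k
      using that by (simp add: power_diff field_simps)
    have d: "1 - z + z * w = 1 - z * (1 - w)" by (simp add: algebra_simps)
    have "v $ k * (1 / (w ^ Suc k * (1 - w) ^ Suc N * (1 - z * (1 - w))))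
       = 1 / (w ^ (N + 1) * (1 - w) ^ (N + 1) * (1 - z + z * w)) * (v $ k * w ^ (N - k))"
      if "k \<le> N" for k
    proof -
      let ?r = "1 / ((1 - w) ^ Suc N * (1 - z * (1 - w)))"
      have "v $ k * (1 / (w ^ Suc k * (1 - w) ^ Suc N * (1 - z * (1 - w)))) = v $ k * (1 / w ^ Suc k * ?r)"
        by (simp add: mult.assoc)
      also have "\<dots> = v $ k * (w ^ (N - k) / w ^ (N + 1) * ?r)"
        using e[OF that] by (simp only:)
      also have "\<dots> = 1 / (w ^ (N + 1) * (1 - w) ^ (N + 1) * (1 - z + z * w)) * (v $ k * w ^ (N - k))"
        unfolding d by (simp add: mult_ac)
      finally show ?thesis .
    qed
    then show "(\<Sum>k\<le>N. v $ k * (1 / (w ^ Suc k * (1 - w) ^ Suc N * (1 - z * (1 - w)))))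
        = pascal_integrand N v z w"
      by (simp only: pascal_integrand_def gen_fun_def sum_distrib_left) (rule sum.cong, auto)
  qed
qed

section \<open>Eigenvectors\<close>

text \<open>\<open>T v\<close> and \<open>v\<close> satisfy the same recurrence, and \<open>v\<close> does not vanish at \<open>0\<close>. Subtracting the multiple
  of \<open>v\<close> that has the same value at \<open>0\<close> leaves an eigenfunction that vanishes at \<open>0\<close>, hence everywhere.\<close>

lemma jacobi_eigenvector_imp_pascal_eigenvector:
  assumes "eigenvector (jacobi_mat N) v \<mu>"
  shows "\<exists>lam. eigenvector (pascal_mat N) v lam"
proof -
  have v: "v \<in> carrier_vec (N + 1)" "v \<noteq> 0\<^sub>v (N + 1)"
    and J: "jacobi_mat N *\<^sub>v v = \<mu> \<cdot>\<^sub>v v"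
    using assms by (auto simp: eigenvector_def jacobi_mat_def)
  have ev: "jacobi_op N (($) v) i = \<mu> * v $ i" if "i \<le> N" for i
    using jacobi_mat_mult_vec[OF v(1) that] J v(1) that by simp
  define T where "T = (\<lambda>i. \<Sum>k\<le>N. of_nat ((i + k) choose i) * v $ k)"
  have T: "jacobi_op N T i = \<mu> * T i" for i
    unfolding T_def by (rule pascal_sum_jacobi_eigenfunction[OF ev])
  have v0: "v $ 0 \<noteq> 0"
  proof
    assume "v $ 0 = 0"
    then have "v $ i = 0" if "i \<le> N" for i
      using jacobi_eigenfunction_zero[of N "($) v" \<mu>] ev that by blast
    then show False using v by (auto simp: vec_eq_iff)
  qed
  define lam where "lam = T 0 / v $ 0"
  have "T i - lam * v $ i = 0" if "i \<le> N" for i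
  proof (rule jacobi_eigenfunction_zero[of N "\<lambda>i. T i - lam * v $ i" \<mu>])
    fix i assume "i \<le> N"
    have "jacobi_op N (\<lambda>i. T i - lam * v $ i) i = jacobi_op N T i - lam * jacobi_op N (($) v) i"
      by (simp add: jacobi_op_def algebra_simps)
    then show "jacobi_op N (\<lambda>i. T i - lam * v $ i) i = \<mu> * (T i - lam * v $ i)"
      using T ev[OF \<open>i \<le> N\<close>] by (simp add: algebra_simps)
  qed (use v0 that in \<open>simp_all add: lam_def\<close>)
  then have "pascal_mat N *\<^sub>v v = lam \<cdot>\<^sub>v v"
    using v(1) pascal_mat_mult_vec[OF v(1)]
    by (intro eq_vecI) (auto simp: T_def pascal_mat_def simp del: index_mult_mat_vec)
  then have "eigenvector (pascal_mat N) v lam"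
    using v by (auto simp: eigenvector_def pascal_mat_def)
  then show ?thesis ..
qed

lemma pascal_eigenvector_integral_equation:
  assumes "eigenvector (pascal_mat N) v lam"
  shows "satisfies_integral_equation N v lam"
  unfolding satisfies_integral_equation_def
proof (intro ballI conjI)
  fix z assume z: "z \<in> integral_domain"
  have v: "v \<in> carrier_vec (N + 1)" and T: "pascal_mat N *\<^sub>v v = lam \<cdot>\<^sub>v v"
    using assms by (auto simp: eigenvector_def pascal_mat_def)
  have "(\<Sum>k\<le>N. of_nat ((m + k) choose m) * v $ k) = lam * v $ m" if "m \<le> N" for m
    using pascal_mat_mult_vec[OF v that] T v that by simp
  then have "(\<Sum>m\<le>N. (\<Sum>k\<le>N. of_nat ((m + k) choose m) * v $ k) * z ^ (N - m)) = lam * gen_fun N v z"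
    by (simp add: gen_fun_def sum_distrib_left mult.assoc)
  with has_line_integral_pascal_integrand[OF z, of N v]
  have "has_line_integral (pascal_integrand N v z) (lam * gen_fun N v z)" by (simp only:)
  then show "vline_integrable (1/2) (pascal_integrand N v z)"
    and "1 / (2 * of_real pi * \<i>) * vline_integral (1/2) (pascal_integrand N v z) = lam * gen_fun N v z"
    by (fact has_line_integral_vline)+
qed

theorem theoremB:
  fixes N :: nat and v :: "complex Matrix.vec" and \<mu> :: complex
  assumes "eigenvector (jacobi_mat N) v \<mu>"
  shows "(\<exists>lam :: complex. eigenvector (pascal_mat N) v lam \<and>
            satisfies_integral_equation N v lam) \<and>
         (\<forall>z :: complex. let y = gen_fun N v; n = (of_nat N :: complex) in
            \<mu> * y z =
              z^2 * (1 - z)^2 * (deriv ^^ 3) y z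
              + 3 * z * (1 - z) * ((n - 1) * z - n) * (deriv ^^ 2) y z
              + n * ((2 * n - 5) * z^2 + (2 - 5 * n) * z + 2 * n + 1) * deriv y z
              + n * ((2 * n + 1) * z + n^2 + n + 1) * y z)"
proof (intro conjI allI)
  show "\<exists>lam. eigenvector (pascal_mat N) v lam \<and> satisfies_integral_equation N v lam"
    using jacobi_eigenvector_imp_pascal_eigenvector[OF assms] pascal_eigenvector_integral_equation
    by blast
next
  fix z :: complex
  have v: "v \<in> carrier_vec (N + 1)" and J: "jacobi_mat N *\<^sub>v v = \<mu> \<cdot>\<^sub>v v"
    using assms by (auto simp: eigenvector_def jacobi_mat_def)
  have "jacobi_op N (($) v) i = \<mu> * v $ i" if "i \<le> N" for i
    using jacobi_mat_mult_vec[OF v that] J v that by simp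
  from gen_fun_differential_eq[of N v \<mu> z, OF this]
  show "let y = gen_fun N v; n = (of_nat N :: complex) in
            \<mu> * y z =
              z^2 * (1 - z)^2 * (deriv ^^ 3) y z
              + 3 * z * (1 - z) * ((n - 1) * z - n) * (deriv ^^ 2) y z
              + n * ((2 * n - 5) * z^2 + (2 - 5 * n) * z + 2 * n + 1) * deriv y z
              + n * ((2 * n + 1) * z + n^2 + n + 1) * y z"
    unfolding Let_def by blast
qed

end
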